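(* Let $p$ be a prime greater than $3$ and let $t\in D_p$. Then modulo $p$: \begin{align*} \sum_{k=0}^{\lfloor p/6\rfloor}S_k t^k&\equiv \frac{3}{4}\left(\frac{p}{3}\right) w_{\lfloor p/6\rfloor}(1-216t),\\ \sum_{k=(p-1)/2}^{\lfloor 5p/6\rfloor}S_kt^k&\equiv -\frac{1}{8}\left(\frac{p}{3}\right)\Bigl(w_{\lfloor 5p/6\rfloor}(1-216t)+w_{\lfloor p/6\rfloor}(1-216t)\Bigr),\\ \sum_{k=0}^{\lfloor p/6\rfloor}(2k+1)S_kt^k&\equiv \frac{1}{2}(-1)^{\frac{p-1}{2}} w_{\lfloor p/6\rfloor}(216t-1),\\ \sum_{k=(p+1)/2}^{\lfloor 5p/6\rfloor}(2k+1)S_kt^k&\equiv \frac{1}{12}(-1)^{\frac{p-1}{2}} \Bigl(w_{\lfloor 5p/6\rfloor}(216t-1)-w_{\lfloor p/6\rfloor}(216t-1)\Bigr). \end{align*}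
   Context: $S_n=\frac{\binom{6n}{3n}\binom{3n}{n}}{2\binom{2n}{n}(2n+1)}$ for $n\ge 0$. The polynomials $w_n(x)$ are defined by $w_0(x)=1$, $w_1(x)=1+2x$, $w_{n+1}(x)=2xw_n(x)-w_{n-1}(x)$. $D_p$ is the set of rationals whose denominator is not divisible by $p$; congruences are in the usual sense. $\left(\frac{p}{3}\right)$ is the Legendre symbol. *)

theory Defs
  imports "HOL-Number_Theory.Number_Theory" "HOL-Computational_Algebra.Polynomial"
begin

definition S :: "nat \<Rightarrow> rat" where
  "S n = of_nat (((6 * n) choose (3 * n)) * ((3 * n) choose n))
         / of_nat (2 * ((2 * n) choose n) * (2 * n + 1))"

fun w :: "nat \<Rightarrow> rat poly" where
  "w 0 = 1"
| "w (Suc 0) = [:1, 2:]"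
| "w (Suc (Suc n)) = [:0, 2:] * w (Suc n) - w n"

text \<open>The second component of \<open>quotient_of r\<close> is the positive denominator of \<open>r\<close> in lowest terms.\<close>

definition D :: "nat \<Rightarrow> rat set" where
  "D p = {r. \<not> int p dvd snd (quotient_of r)}"

definition rat_cong :: "rat \<Rightarrow> rat \<Rightarrow> nat \<Rightarrow> bool" where
  "rat_cong a b p \<longleftrightarrow> a \<in> D p \<and> b \<in> D p \<and> (\<exists>c \<in> D p. a - b = of_nat p * c)"

end

theory Submission
  imports Defs
begin

text \<open>
  Put \<open>n = \<lfloor>p/6\<rfloor>\<close>, \<open>M = \<lfloor>5p/6\<rfloor> = p - 1 - n\<close> and \<open>c(N,k) = binomial(N+k, 2k) (-432)^k\<close>.
  Expanding \<open>w N\<close> at \<open>\<plusminus>(1 - 216t)\<close> gives, up to a sign, the coefficients \<open>c(N,k)\<close>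
  and \<open>(2N+1)/(2k+1) c(N,k)\<close>. Comparing ratios of consecutive terms,
  \<open>2(2k+1) S_k\<close> equals \<open>c(N,k)\<close> times the product over \<open>j < k\<close> of
  \<open>-(6j+1)(6j+5) / (36(N+j+1)(N-j))\<close>. For \<open>N = n\<close> and \<open>N = M\<close> one has
  \<open>(6N+1)(6N+5) \<equiv> 0\<close>, so every factor is \<open>1\<close> modulo \<open>p\<close>, except the one with
  \<open>N = M\<close>, \<open>j = n\<close>, where a \<open>p\<close> cancels and the value is \<open>1/6\<close>. Since also
  \<open>c(M,k) \<equiv> c(n,k)\<close> for \<open>k \<le> (p-1)/2\<close>, only the upper half of the range survives
  in the combinations of \<open>w M\<close> and \<open>w n\<close>.
\<close>

section \<open>The ring of \<open>p\<close>-integral rationals\<close>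

text \<open>Admitting any denominator prime to \<open>p\<close>, not just the reduced one, spares
  the closure proofs all cancellation. The reduced denominator divides every other one by
  coprimality.\<close>

lemma D_iff: "r \<in> D p \<longleftrightarrow> (\<exists>a b. \<not> int p dvd b \<and> r = of_int a / of_int b)"
proof
  assume "r \<in> D p"
  moreover have "r = of_int (fst (quotient_of r)) / of_int (snd (quotient_of r))"
    by (metis prod.collapse quotient_of_div)
  ultimately show "\<exists>a b. \<not> int p dvd b \<and> r = of_int a / of_int b"
    unfolding D_def by blast
next
  assume "\<exists>a b. \<not> int p dvd b \<and> r = of_int a / of_int b"
  then obtain a b where b: "\<not> int p dvd b" and r: "r = of_int a / of_int b"
    by blast
  obtain x y where xy: "quotient_of r = (x, y)"
    by fastforce
  have y: "y > 0" "coprime x y" "r = of_int x / of_int y"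
    using xy quotient_of_denom_pos quotient_of_coprime quotient_of_div by auto
  have "b \<noteq> 0"
    using b by auto
  with y r have "(of_int (a * y) :: rat) = of_int (x * b)"
    by (simp add: field_simps)
  hence "a * y = x * b"
    by (simp only: of_int_eq_iff)
  hence "y dvd x * b"
    by (metis dvd_triv_right)
  hence "y dvd b"
    using y(2) by (simp add: coprime_dvd_mult_right_iff coprime_commute)
  with b show "r \<in> D p"
    unfolding D_def xy using dvd_trans xy by auto
qed

lemma rat_cong_D: "rat_cong a b p \<Longrightarrow> a \<in> D p" "rat_cong a b p \<Longrightarrow> b \<in> D p"
  by (auto simp: rat_cong_def)

context
  fixes p :: nat
  assumes p: "prime p"
begin

lemma D_of_int: "of_int a \<in> D p"
  using p unfolding D_iff
  by (intro exI[of _ a] exI[of _ 1]) (auto dest: prime_gt_1_nat)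

lemma D_of_nat: "of_nat a \<in> D p"
  using D_of_int[of "int a"] by simp

lemma D_numeral: "0 \<in> D p" "1 \<in> D p" "numeral m \<in> D p"
  using D_of_int[of 0] D_of_int[of 1] D_of_int[of "numeral m"] by simp_all

lemma D_mult:
  assumes "a \<in> D p" "b \<in> D p"
  shows "a * b \<in> D p"
proof -
  from assms obtain x y u v where
    "\<not> int p dvd y" "a = of_int x / of_int y" "\<not> int p dvd v" "b = of_int u / of_int v"
    unfolding D_iff by blast
  thus ?thesis
    unfolding D_iff using p
    by (intro exI[of _ "x * u"] exI[of _ "y * v"]) (simp add: prime_dvd_mult_iff)
qed

lemma D_add:
  assumes "a \<in> D p" "b \<in> D p"
  shows "a + b \<in> D p"
proof -
  from assms obtain x y u v where *:
    "\<not> int p dvd y" "a = of_int x / of_int y" "\<not> int p dvd v" "b = of_int u / of_int v"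
    unfolding D_iff by blast
  hence "y \<noteq> 0" "v \<noteq> 0"
    by auto
  with * show ?thesis
    unfolding D_iff using p
    by (intro exI[of _ "x * v + u * y"] exI[of _ "y * v"])
       (simp add: prime_dvd_mult_iff field_simps)
qed

lemma D_uminus: "a \<in> D p \<Longrightarrow> - a \<in> D p"
  using D_mult[OF D_of_int[of "-1"], of a] by simp

lemma D_diff: "a \<in> D p \<Longrightarrow> b \<in> D p \<Longrightarrow> a - b \<in> D p"
  using D_add[OF _ D_uminus, of a b] by simp

lemma D_divide:
  assumes "a \<in> D p" "\<not> p dvd m"
  shows "a / of_nat m \<in> D p"
proof -
  have "1 / of_nat m \<in> D p"
    unfolding D_iff using assms(2) by (intro exI[of _ 1] exI[of _ "int m"]) simp
  from D_mult[OF assms(1) this] show ?thesis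
    by simp
qed

lemma D_power: "a \<in> D p \<Longrightarrow> a ^ k \<in> D p"
  by (induction k) (auto intro: D_mult D_numeral)

lemmas D_intros = D_of_int D_of_nat D_numeral D_mult D_add D_uminus D_diff D_power

text \<open>Integrality of \<open>a\<close> is inherited through the equation, so a congruence is
  proved by exhibiting the quotient \<open>c\<close>.\<close>

lemma rat_congI: "b \<in> D p \<Longrightarrow> c \<in> D p \<Longrightarrow> a = b + of_nat p * c \<Longrightarrow> rat_cong a b p"
  unfolding rat_cong_def by (auto intro!: D_intros)

lemma rat_cong_refl: "a \<in> D p \<Longrightarrow> rat_cong a a p"
  by (rule rat_congI[of _ 0]) (auto intro: D_intros)

lemma rat_cong_sym: "rat_cong a b p \<Longrightarrow> rat_cong b a p"
  unfolding rat_cong_def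
  by (metis D_uminus minus_diff_eq mult_minus_right)

lemma rat_cong_add:
  assumes "rat_cong a b p" "rat_cong c d p"
  shows "rat_cong (a + c) (b + d) p"
proof -
  from assms obtain x y where "x \<in> D p" "y \<in> D p" "a - b = of_nat p * x" "c - d = of_nat p * y"
    "b \<in> D p" "d \<in> D p"
    unfolding rat_cong_def by blast
  thus ?thesis
    by (intro rat_congI[of _ "x + y"] D_intros) (auto simp: algebra_simps)
qed

lemma rat_cong_trans:
  assumes "rat_cong a b p" "rat_cong b c p"
  shows "rat_cong a c p"
proof -
  from assms obtain x y where "x \<in> D p" "y \<in> D p" "a - b = of_nat p * x" "b - c = of_nat p * y"
    "c \<in> D p"
    unfolding rat_cong_def by blast
  thus ?thesis
    by (intro rat_congI[of _ "x + y"] D_intros) (auto simp: algebra_simps)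
qed

lemma rat_cong_mult:
  assumes "rat_cong a b p" "rat_cong c d p"
  shows "rat_cong (a * c) (b * d) p"
proof -
  from assms obtain x y where "x \<in> D p" "y \<in> D p" "a = b + of_nat p * x" "c = d + of_nat p * y"
    "b \<in> D p" "d \<in> D p"
    unfolding rat_cong_def by (metis add.commute diff_add_cancel)
  thus ?thesis
    by (intro rat_congI[of _ "x * d + b * y + of_nat p * x * y"] D_intros)
       (auto simp: algebra_simps)
qed

lemma rat_cong_mult_left: "c \<in> D p \<Longrightarrow> rat_cong a b p \<Longrightarrow> rat_cong (c * a) (c * b) p"
  by (intro rat_cong_mult rat_cong_refl)

lemma rat_cong_mult_right: "c \<in> D p \<Longrightarrow> rat_cong a b p \<Longrightarrow> rat_cong (a * c) (b * c) p"
  by (intro rat_cong_mult rat_cong_refl)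

lemma rat_cong_sum:
  "(\<And>k. k \<in> A \<Longrightarrow> rat_cong (f k) (g k) p) \<Longrightarrow> rat_cong (sum f A) (sum g A) p"
  by (induction A rule: infinite_finite_induct)
     (auto intro!: rat_cong_add rat_cong_refl D_intros)

lemma rat_cong_prod:
  "(\<And>k. k \<in> A \<Longrightarrow> rat_cong (f k) (g k) p) \<Longrightarrow> rat_cong (prod f A) (prod g A) p"
  by (induction A rule: infinite_finite_induct)
     (auto intro!: rat_cong_mult rat_cong_refl D_intros)

end

section \<open>Explicit formulas for \<open>w n\<close>\<close>

text \<open>
  In terms of Chebyshev polynomials of the second kind, \<open>Ub n z\<close> is \<open>U_n(1 + z/2)\<close>, and
  \<open>Vb n z\<close> is \<open>U_n(1 + z/2) - U_{n-1}(1 + z/2)\<close>.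
\<close>

definition Ub :: "nat \<Rightarrow> rat \<Rightarrow> rat" where
  "Ub n z = (\<Sum>k\<le>n. of_nat ((n + k + 1) choose (2 * k + 1)) * z ^ k)"

definition Vb :: "nat \<Rightarrow> rat \<Rightarrow> rat" where
  "Vb n z = (\<Sum>k\<le>n. of_nat ((n + k) choose (2 * k)) * z ^ k)"

text \<open>Pascal's rule on binomial(n+k+2, 2k+2): the part with lower index 2k+1 yields
  \<open>z * Ub n z\<close>.\<close>

lemma Vb_Suc: "Vb (Suc n) z = Vb n z + z * Ub n z"
proof -
  have "Vb (Suc n) z = 1 + (\<Sum>k\<le>n. of_nat ((n + k + 2) choose (2 * k + 2)) * z ^ Suc k)"
    unfolding Vb_def by (subst sum.atMost_Suc_shift) simp
  also have "(\<Sum>k\<le>n. of_nat ((n + k + 2) choose (2 * k + 2)) * z ^ Suc k) =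
      (\<Sum>k\<le>n. of_nat ((n + Suc k) choose (2 * Suc k)) * z ^ Suc k) + z * Ub n z"
    unfolding Ub_def sum_distrib_left sum.distrib[symmetric]
    by (intro sum.cong) (auto simp: algebra_simps)
  also have "(\<Sum>k\<le>n. of_nat ((n + Suc k) choose (2 * Suc k)) * z ^ Suc k) = Vb n z - 1"
  proof -
    \<comment> \<open>The added term k = n+1 is binomial(2n+1, 2n+2) = 0; it makes the range fit the
      index shift.\<close>
    have "Vb n z = (\<Sum>k\<le>Suc n. of_nat ((n + k) choose (2 * k)) * z ^ k)"
      unfolding Vb_def by (simp add: binomial_eq_0)
    also have "\<dots> = 1 + (\<Sum>k\<le>n. of_nat ((n + Suc k) choose (2 * Suc k)) * z ^ Suc k)"
      by (subst sum.atMost_Suc_shift) simp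
    finally show ?thesis
      by simp
  qed
  finally show ?thesis
    by simp
qed

lemma Ub_Suc: "Ub (Suc n) z = Ub n z + Vb (Suc n) z"
proof -
  have "Ub (Suc n) z = (\<Sum>k\<le>Suc n. of_nat ((n + k + 1) choose (2 * k + 1)) * z ^ k) + Vb (Suc n) z"
    unfolding Ub_def Vb_def sum.distrib[symmetric]
    by (intro sum.cong) (auto simp: algebra_simps)
  also have "(\<Sum>k\<le>Suc n. of_nat ((n + k + 1) choose (2 * k + 1)) * z ^ k) = Ub n z"
    unfolding Ub_def by (simp add: binomial_eq_0)
  finally show ?thesis .
qed

text \<open>With x = 1 - 2y, the identity w_n = U_n + U_{n-1} and the parity of U_n give w_n(-x) =
  (-1)^n (U_n(x) - U_{n-1}(x)). The proof eliminates \<open>Ub\<close> from the mixed recurrences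
  and compares three-term recurrences.\<close>

lemma poly_w_Vb: "poly (w n) (2 * y - 1) = (- 1) ^ n * Vb n (- 4 * y)"
proof (induction n rule: w.induct)
  case 1
  show ?case
    by (simp add: Vb_def)
next
  case 2
  show ?case
    by (simp add: Vb_def numeral_eq_Suc)
next
  case (3 n)
  have "Vb (Suc (Suc n)) (- 4 * y) = (2 - 4 * y) * Vb (Suc n) (- 4 * y) - Vb n (- 4 * y)"
    using Vb_Suc[of n "- 4 * y"] Vb_Suc[of "Suc n" "- 4 * y"] Ub_Suc[of n "- 4 * y"]
    by (simp add: algebra_simps)
  note rec = this
  show ?case
    unfolding w.simps poly_diff poly_mult 3 rec by (simp add: algebra_simps)
qed

text \<open>This is w_{n+1} = U_{n+1} + U_n; starting at \<open>Suc n\<close> avoids U_{-1}.\<close>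

lemma poly_w_Ub: "poly (w (Suc n)) (1 - 2 * y) = Ub (Suc n) (- 4 * y) + Ub n (- 4 * y)"
proof (induction n rule: induct_nat_012)
  case 0
  show ?case
    by (simp add: Ub_def numeral_2_eq_2 numeral_3_eq_3)
next
  case 1
  show ?case
    by (simp add: Ub_def numeral_2_eq_2 numeral_3_eq_3 algebra_simps)
next
  case (ge2 n)
  have rec: "Ub (Suc (Suc m)) (- 4 * y) = (2 - 4 * y) * Ub (Suc m) (- 4 * y) - Ub m (- 4 * y)" for m
    using Ub_Suc[of m "- 4 * y"] Vb_Suc[of "Suc m" "- 4 * y"] Ub_Suc[of "Suc m" "- 4 * y"]
    by (simp add: algebra_simps)
  have "poly (w (Suc (Suc (Suc n)))) (1 - 2 * y) =
      2 * (1 - 2 * y) * poly (w (Suc (Suc n))) (1 - 2 * y) - poly (w (Suc n)) (1 - 2 * y)"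
    by (simp add: algebra_simps)
  thus ?case
    unfolding ge2 rec[of "Suc n"] rec[of n] by (simp add: algebra_simps)
qed

lemma Suc_times_choose_Suc: "Suc k * (n choose Suc k) = (n - k) * (n choose k)"
proof (cases "k \<le> n")
  case True
  have "Suc k * (n choose k) + Suc k * (n choose Suc k) = Suc n * (n choose k)"
    using Suc_times_binomial[of k n] by (simp add: algebra_simps)
  also have "Suc n = Suc k + (n - k)"
    using True by simp
  finally show ?thesis
    unfolding add_mult_distrib by simp
qed (simp add: binomial_eq_0)

text \<open>After multiplication by 2k+1, both binomials are multiples of binomial(n+k, 2k), with
  multipliers n+k+1 and n-k, whose sum is 2n+1.\<close>

lemma choose_odd_add:
  assumes "k \<le> n"
  shows "(2 * k + 1) * (((n + k + 1) choose (2 * k + 1)) + ((n + k) choose (2 * k + 1))) =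
         (2 * n + 1) * ((n + k) choose (2 * k))"
proof -
  have 1: "(2 * k + 1) * ((n + k + 1) choose (2 * k + 1)) = (n + k + 1) * ((n + k) choose (2 * k))"
    using Suc_times_binomial[of "2 * k" "n + k"] by simp
  have 2: "(2 * k + 1) * ((n + k) choose (2 * k + 1)) = (n - k) * ((n + k) choose (2 * k))"
    using Suc_times_choose_Suc[of "2 * k" "n + k"] by simp
  have "2 * n + 1 = (n + k + 1) + (n - k)"
    using assms by simp
  thus ?thesis
    unfolding add_mult_distrib2 1 2 by (simp only: add_mult_distrib)
qed

text \<open>The factor 2n+1 is kept apart because modulo \<open>p\<close> it will combine with the
  Legendre symbol.\<close>

lemma poly_w_odd_quotient:
  "poly (w n) (1 - 2 * y) =
     (\<Sum>k\<le>n. of_nat (2 * n + 1) * (of_nat ((n + k) choose (2 * k)) / of_nat (2 * k + 1)) * (- 4 * y) ^ k)"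
proof (cases n)
  case 0
  thus ?thesis
    by simp
next
  case (Suc m)
  \<comment> \<open>The second sum comes from \<open>Ub m\<close> with m = n-1; its extra term
    binomial(2n, 2n+1) is 0.\<close>
  have "poly (w n) (1 - 2 * y) =
      (\<Sum>k\<le>n. of_nat ((n + k + 1) choose (2 * k + 1)) * (- 4 * y) ^ k) +
      (\<Sum>k\<le>n. of_nat ((n + k) choose (2 * k + 1)) * (- 4 * y) ^ k)"
    unfolding Suc poly_w_Ub by (simp add: Ub_def binomial_eq_0)
  also have "\<dots> = (\<Sum>k\<le>n. of_nat (((n + k + 1) choose (2 * k + 1)) + ((n + k) choose (2 * k + 1)))
                     * (- 4 * y) ^ k)"
    unfolding sum.distrib[symmetric] by (simp only: of_nat_add distrib_right)
  also have "\<dots> = (\<Sum>k\<le>n. of_nat (2 * n + 1) * (of_nat ((n + k) choose (2 * k)) / of_nat (2 * k + 1)) * (- 4 * y) ^ k)"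
  proof (rule sum.cong)
    fix k assume "k \<in> {..n}"
    hence "k \<le> n"
      by simp
    define a b c d :: rat where "a = of_nat (2 * k + 1)"
      and "b = of_nat (((n + k + 1) choose (2 * k + 1)) + ((n + k) choose (2 * k + 1)))"
      and "c = of_nat (2 * n + 1)" and "d = of_nat ((n + k) choose (2 * k))"
    have "a * b = c * d"
      unfolding a_def b_def c_def d_def of_nat_mult[symmetric] choose_odd_add[OF \<open>k \<le> n\<close>] ..
    moreover have "a \<noteq> 0"
      unfolding a_def of_nat_eq_0_iff by simp
    ultimately have "b * (- 4 * y) ^ k = c * (d / a) * (- 4 * y) ^ k"
      by (simp add: field_simps)
    thus "of_nat (((n + k + 1) choose (2 * k + 1)) + ((n + k) choose (2 * k + 1))) * (- 4 * y) ^ k =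
        of_nat (2 * n + 1) * (of_nat ((n + k) choose (2 * k)) / of_nat (2 * k + 1)) * (- 4 * y) ^ k"
      unfolding a_def b_def c_def d_def .
  qed simp
  finally show ?thesis .
qed

section \<open>The numbers \<open>S k\<close> as perturbed coefficients\<close>

text \<open>The factor 2(2k+1) clears the non-binomial denominator of \<open>S k\<close>; from
  factorials the ratio of consecutive terms can be read off.\<close>

lemma S_eq_fact:
  "2 * of_nat (2 * k + 1) * S k = fact (6 * k) * fact k / (fact (3 * k) * fact (2 * k) ^ 2)"
proof -
  have nz: "(2 * of_nat (2 * k + 1) :: rat) \<noteq> 0"
    by (simp add: add_eq_0_iff_both_eq_0 del: of_nat_Suc)
  have "2 * of_nat (2 * k + 1) * S k =
     of_nat ((6 * k) choose (3 * k)) * of_nat ((3 * k) choose k) / of_nat ((2 * k) choose k)"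
  proof -
    have "S k = of_nat ((6 * k) choose (3 * k)) * of_nat ((3 * k) choose k) /
        ((2 * of_nat (2 * k + 1)) * of_nat ((2 * k) choose k))"
      unfolding S_def of_nat_mult by (simp add: mult_ac)
    with nz show ?thesis
      by simp
  qed
  also have "of_nat ((6 * k) choose (3 * k)) = (fact (6 * k) / (fact (3 * k) * fact (3 * k)) :: rat)"
    using binomial_fact[of "3 * k" "6 * k", where ?'a = rat] by simp
  also have "of_nat ((3 * k) choose k) = (fact (3 * k) / (fact k * fact (2 * k)) :: rat)"
    using binomial_fact[of k "3 * k", where ?'a = rat] by simp
  also have "of_nat ((2 * k) choose k) = (fact (2 * k) / (fact k * fact k) :: rat)"
    using binomial_fact[of k "2 * k", where ?'a = rat] by simp
  finally show ?thesis
    by (simp add: field_simps power2_eq_square)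
qed

lemma S_Suc:
  "of_nat ((2 * k + 1) * (2 * k + 2)) * (2 * of_nat (2 * Suc k + 1) * S (Suc k)) =
   12 * of_nat ((6 * k + 1) * (6 * k + 5)) * (2 * of_nat (2 * k + 1) * S k)"
proof -
  define x where "x = (of_nat k :: rat)"
  have x: "x \<ge> 0"
    by (simp add: x_def)
  \<comment> \<open>Of the six new factors of (6k+6)!, the even ones give 8P, and P cancels against
    (3k+3)!; moreover 6k+3 = 3(2k+1).\<close>
  define P where "P = (3 * x + 1) * (3 * x + 2) * (3 * x + 3)"
  have "6 * Suc k = Suc (Suc (Suc (Suc (Suc (Suc (6 * k))))))"
    by simp
  hence f6: "fact (6 * Suc k) = (8 * (6 * x + 1) * (3 * (2 * x + 1)) * (6 * x + 5) * P * fact (6 * k) :: rat)"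
    by (simp only: fact_Suc of_nat_mult of_nat_Suc of_nat_numeral x_def P_def) (simp add: field_simps)
  have "3 * Suc k = Suc (Suc (Suc (3 * k)))"
    by simp
  hence f3: "fact (3 * Suc k) = (P * fact (3 * k) :: rat)"
    by (simp only: fact_Suc of_nat_mult of_nat_Suc of_nat_numeral x_def P_def) (simp add: field_simps)
  have "2 * Suc k = Suc (Suc (2 * k))"
    by simp
  hence f2: "fact (2 * Suc k) = ((2 * x + 1) * (2 * (x + 1)) * fact (2 * k) :: rat)"
    by (simp only: fact_Suc of_nat_mult of_nat_Suc of_nat_numeral x_def) (simp add: field_simps)
  have f1: "fact (Suc k) = ((x + 1) * fact k :: rat)"
    by (simp add: x_def)
  have e: "of_nat ((2 * k + 1) * (2 * k + 2)) = (2 * x + 1) * (2 * (x + 1))"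
     "of_nat ((6 * k + 1) * (6 * k + 5)) = (6 * x + 1) * (6 * x + 5)"
    by (simp_all add: x_def algebra_simps)
  have alg: "(a * (2 * c)) * (8 * u * (3 * a) * v * P * F6 * (c * F1) / (P * F3 * (a * (2 * c) * F2) ^ 2)) =
       12 * (u * v) * (F6 * F1 / (F3 * F2 ^ 2))"
    if "a \<noteq> 0" "c \<noteq> 0" "P \<noteq> 0" "F2 \<noteq> 0" "F3 \<noteq> 0" for a c u v P F1 F2 F3 F6 :: rat
    using that by (simp add: field_simps power2_eq_square)
  have nz: "2 * x + 1 \<noteq> 0" "x + 1 \<noteq> 0" "P \<noteq> 0"
    using x by (auto simp: P_def add_nonneg_eq_0_iff)
  show ?thesis
    unfolding S_eq_fact f6 f3 f2 f1 e using nz by (intro alg) simp_all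
qed

section \<open>The coefficients c(N,k) and their ratio to the numbers \<open>S k\<close>\<close>

text \<open>The base -432 is -4 * 108: writing 216t = 2y gives y = 108t, and the expansions above
  run in powers of -4y.\<close>

definition wcoeff :: "nat \<Rightarrow> nat \<Rightarrow> rat" where
  "wcoeff N k = of_nat ((N + k) choose (2 * k)) * (- 432) ^ k"

lemma wcoeff_eq_0: "N < k \<Longrightarrow> wcoeff N k = 0"
  by (simp add: wcoeff_def binomial_eq_0)

text \<open>Here -432 is split as -12 * 36, so that dividing \<open>S_Suc\<close> by this recurrence
  leaves exactly \<open>factor N k\<close>. For k \<ge> N both sides vanish.\<close>

lemma wcoeff_Suc:
  "of_nat ((2 * k + 1) * (2 * k + 2)) * wcoeff N (Suc k) =
   - 12 * of_nat (36 * (N + k + 1) * (N - k)) * wcoeff N k"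
proof -
  have "(2 * k + 1) * (2 * k + 2) * ((N + Suc k) choose (2 * Suc k)) =
        (2 * k + 1) * (Suc (2 * k + 1) * (Suc (N + k) choose Suc (2 * k + 1)))"
  proof -
    have "N + Suc k = Suc (N + k)" "2 * Suc k = Suc (2 * k + 1)" "2 * k + 2 = Suc (2 * k + 1)"
      by simp_all
    thus ?thesis
      by (simp only: mult.assoc)
  qed
  also have "\<dots> = (N + k + 1) * (Suc (2 * k) * ((N + k) choose Suc (2 * k)))"
    unfolding Suc_times_binomial by (simp only: Suc_eq_plus1 mult_ac)
  also have "\<dots> = (N + k + 1) * (N - k) * ((N + k) choose (2 * k))"
  proof -
    have "N + k - 2 * k = N - k"
      by simp
    thus ?thesis
      unfolding Suc_times_choose_Suc by (simp only: mult.assoc)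
  qed
  finally have "(of_nat ((2 * k + 1) * (2 * k + 2)) * of_nat ((N + Suc k) choose (2 * Suc k)) :: rat) =
      of_nat ((N + k + 1) * (N - k)) * of_nat ((N + k) choose (2 * k))"
    by (simp only: of_nat_mult[symmetric])
  moreover have "(of_nat (36 * (N + k + 1) * (N - k)) :: rat) = 36 * of_nat ((N + k + 1) * (N - k))"
    by (simp only: of_nat_mult of_nat_numeral mult.assoc)
  ultimately show ?thesis
    unfolding wcoeff_def power_Suc by (simp add: mult.assoc[symmetric] del: of_nat_mult of_nat_Suc of_nat_add binomial_Suc_Suc)
qed

definition factor :: "nat \<Rightarrow> nat \<Rightarrow> rat" where
  "factor N j = - of_nat ((6 * j + 1) * (6 * j + 5)) / of_nat (36 * (N + j + 1) * (N - j))"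

text \<open>Both sides are 1 at k = 0 and have the same ratio of consecutive terms; k \<le> N keeps
  every denominator of \<open>factor\<close> nonzero.\<close>

lemma S_eq_wcoeff_prod:
  assumes "k \<le> N"
  shows "2 * of_nat (2 * k + 1) * S k = wcoeff N k * (\<Prod>j<k. factor N j)"
  using assms
proof (induction k)
  case 0
  show ?case
    by (simp add: S_def wcoeff_def)
next
  case (Suc k)
  define d where "d = (of_nat ((2 * k + 1) * (2 * k + 2)) :: rat)"
  define e where "e = (of_nat (36 * (N + k + 1) * (N - k)) :: rat)"
  define u where "u = (of_nat ((6 * k + 1) * (6 * k + 5)) :: rat)"
  define R where "R = (\<Prod>j<k. factor N j)"
  have d: "d \<noteq> 0" and e: "e \<noteq> 0"
    using Suc.prems unfolding d_def e_def of_nat_eq_0_iff by auto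
  have IH: "2 * of_nat (2 * k + 1) * S k = wcoeff N k * R"
    using Suc by (simp add: R_def)
  have "d * (2 * of_nat (2 * Suc k + 1) * S (Suc k)) = 12 * u * (wcoeff N k * R)"
    unfolding d_def u_def S_Suc IH ..
  also have "\<dots> = - 12 * e * wcoeff N k * (R * (- u / e))"
    using e by simp
  also have "- 12 * e * wcoeff N k = d * wcoeff N (Suc k)"
    unfolding d_def e_def wcoeff_Suc ..
  finally have "d * (2 * of_nat (2 * Suc k + 1) * S (Suc k)) = d * (wcoeff N (Suc k) * (R * (- u / e)))"
    by (simp only: mult_ac)
  moreover have "(\<Prod>j<Suc k. factor N j) = R * (- u / e)"
    by (simp add: R_def factor_def u_def e_def)
  ultimately show ?case
    using d by (metis mult_left_cancel)
qed

lemma poly_w_even: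
  "poly (w N) (216 * t - 1) = (- 1) ^ N * (\<Sum>k\<le>N. wcoeff N k * t ^ k)"
proof -
  have "(- 4 * (108 * t)) ^ k = (- 432) ^ k * t ^ k" for k
    unfolding power_mult_distrib[symmetric] by simp
  with poly_w_Vb[of N "108 * t"] show ?thesis
    by (simp add: Vb_def wcoeff_def mult.assoc)
qed

lemma poly_w_odd:
  "poly (w N) (1 - 216 * t) =
     of_nat (2 * N + 1) * (\<Sum>k\<le>N. wcoeff N k / of_nat (2 * k + 1) * t ^ k)"
proof -
  have pow: "(- 4 * (108 * t)) ^ k = (- 432) ^ k * t ^ k" for k
    unfolding power_mult_distrib[symmetric] by simp
  have "1 - 216 * t = 1 - 2 * (108 * t)"
    by simp
  hence "poly (w N) (1 - 216 * t) = poly (w N) (1 - 2 * (108 * t))"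
    by (simp only:)
  thus ?thesis
    unfolding poly_w_odd_quotient sum_distrib_left wcoeff_def pow times_divide_eq_left times_divide_eq_right
    by (simp only: mult_ac)
qed

section \<open>Congruences modulo \<open>p\<close>\<close>

text \<open>\<open>p\<close> divides (a+b)! but neither a! nor b!.\<close>

lemma prime_dvd_choose_add:
  assumes "prime (p :: nat)" "a < p" "b < p" "p \<le> a + b"
  shows "p dvd ((a + b) choose a)"
proof -
  have "fact a * fact b * ((a + b) choose a) = (fact (a + b) :: nat)"
    using binomial_fact_lemma[of a "a + b"] by simp
  moreover have "p dvd fact (a + b)" "\<not> p dvd fact a" "\<not> p dvd fact b"
    using assms by (auto simp: prime_dvd_fact_iff)
  ultimately show ?thesis
    using assms(1) by (metis prime_dvd_mult_iff)
qed

section \<open>Arithmetic of \<open>p\<close> modulo 6 and units modulo \<open>p\<close>\<close>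

context
  fixes p n M h :: nat
  assumes p: "prime p" and p3: "p > 3"
  defines "n \<equiv> p div 6" and "M \<equiv> 5 * p div 6" and "h \<equiv> (p - 1) div 2"
begin

text \<open>A prime above 3 is 1 or 5 modulo 6, so all the floors become linear in \<open>n\<close>.
  In the first case n > 0 keeps the denominator 4n of the exceptional factor nonzero.\<close>

lemma residue_cases:
  obtains "p = 6 * n + 1" "M = 5 * n" "h = 3 * n" "n > 0"
        | "p = 6 * n + 5" "M = 5 * n + 4" "h = 3 * n + 2"
proof -
  have "\<not> 2 dvd p" "\<not> 3 dvd p"
    using p p3 by (auto simp: prime_nat_iff)
  hence "p mod 6 = 1 \<or> p mod 6 = 5"
    by presburger
  thus ?thesis
  proof
    assume "p mod 6 = 1"
    hence "p = 6 * n + 1"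
      unfolding n_def by presburger
    thus ?thesis
      using p3 by (intro that(1)) (auto simp: M_def h_def)
  next
    assume "p mod 6 = 5"
    hence "p = 6 * n + 5"
      unfolding n_def by presburger
    thus ?thesis
      by (intro that(2)) (auto simp: M_def h_def)
  qed
qed

lemma bounds: "M + n + 1 = p" "n < h" "h < M" "2 * h + 1 = p"
  by (rule residue_cases; simp)+

text \<open>One of 6n+1 and 6n+5 equals \<open>p\<close>. The reflection x to -1-x swaps the two
  linear factors up to sign and sends \<open>n\<close> to \<open>M\<close> modulo
  \<open>p\<close>.\<close>

lemma root_mod_p:
  "p dvd (6 * n + 1) * (6 * n + 5)" "p dvd (6 * M + 1) * (6 * M + 5)"
proof -
  show "p dvd (6 * n + 1) * (6 * n + 5)"
    by (rule residue_cases) (metis dvd_triv_left, metis dvd_triv_right)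
  show "p dvd (6 * M + 1) * (6 * M + 5)"
  proof (rule residue_cases)
    assume "p = 6 * n + 1" "M = 5 * n"
    hence "6 * M + 5 = p * 5"
      by simp
    thus ?thesis
      by (metis dvd_mult dvd_triv_left)
  next
    assume "p = 6 * n + 5" "M = 5 * n + 4"
    hence "6 * M + 1 = p * 5"
      by simp
    thus ?thesis
      by (metis dvd_mult2 dvd_triv_left)
  qed
qed

text \<open>144 is a common multiple of all the constant denominators that occur below.\<close>

lemma not_dvd_144: "\<not> p dvd 144"
proof
  assume "p dvd 144"
  also have "(144 :: nat) = 2 ^ 4 * 3 ^ 2"
    by simp
  finally have "p dvd 2 \<or> p dvd 3"
    using p by (metis prime_dvd_mult_iff prime_dvd_power_nat)
  thus False
    using p3 by (auto dest: dvd_imp_le)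
qed

lemma D_divide_144:
  assumes "a \<in> D p" "numeral m dvd (144 :: nat)"
  shows "a / numeral m \<in> D p"
proof -
  have "\<not> p dvd numeral m"
    using not_dvd_144 assms(2) dvd_trans by blast
  from D_divide[OF p assms(1) this] show ?thesis
    by (simp only: of_nat_numeral)
qed

text \<open>Meant for N+j+1 and 2k+1, which stay below 2p and so are divisible by \<open>p\<close>
  only when equal to it.\<close>

lemma not_dvd_below_double:
  assumes "0 < q" "q < 2 * p" "q \<noteq> p"
  shows "\<not> p dvd q"
proof
  assume "p dvd q"
  then obtain r where "q = p * r"
    by auto
  with assms have "0 < r" "r < 2" "r \<noteq> 1"
    by auto
  thus False
    by simp
qed

section \<open>The factors modulo \<open>p\<close>\<close>

lemma wcoeff_D: "wcoeff N k \<in> D p"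
  unfolding wcoeff_def by (intro D_intros p)

text \<open>The identity (6j+1)(6j+5) + 36(N+j+1)(N-j) = (6N+1)(6N+5) shows that numerator and
  denominator of \<open>factor N j\<close> agree modulo \<open>p\<close>; the remaining hypotheses
  make the denominator a unit.\<close>

lemma factor_cong_1:
  assumes "j < N" "N < p" "p dvd (6 * N + 1) * (6 * N + 5)" "\<not> p dvd N + j + 1"
  shows "rat_cong (factor N j) 1 p"
proof -
  define e where "e = 36 * (N + j + 1) * (N - j)"
  define u where "u = (6 * j + 1) * (6 * j + 5)"
  have "\<not> p dvd 36"
    using not_dvd_144 dvd_trans[of p 36 144] by auto
  moreover have "\<not> p dvd N - j"
    using assms by (auto dest: dvd_imp_le)
  ultimately have e: "\<not> p dvd e"
    using p assms(4) unfolding e_def by (simp only: prime_dvd_mult_iff) simp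
  obtain d where "N = j + d"
    using assms(1) less_imp_add_positive by blast
  hence "u + e = (6 * N + 1) * (6 * N + 5)"
    unfolding u_def e_def by (simp add: algebra_simps)
  with assms(3) obtain q where "u + e = p * q"
    by auto
  hence q: "of_nat u + of_nat e = (of_nat p * of_nat q :: rat)"
    by (metis of_nat_add of_nat_mult)
  have "e \<noteq> 0"
    using e by (metis dvd_0_right)
  hence eq: "- of_nat u / of_nat e = (1 + of_nat p * (- of_nat q / of_nat e) :: rat)"
    using q by (simp add: field_simps)
  have "- of_nat q / of_nat e \<in> D p"
    using e p by (intro D_divide D_intros)
  from rat_congI[OF p D_numeral(2)[OF p] this eq] show ?thesis
    unfolding factor_def u_def e_def .
qed

text \<open>Here M+n+1 = p cancels against whichever of 6n+1 and 6n+5 equals \<open>p\<close>. What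
  remains is -(6n+5)/(144n) or -(6n+1)/(144(n+1)), and 6n \<equiv> -1 or 6n \<equiv> -5 turns it
  into 1/6.\<close>

lemma factor_exceptional: "rat_cong (factor M n) (1 / 6) p"
proof -
  have sixth: "1 / 6 \<in> D p"
    by (intro D_divide_144 D_intros p) auto
  \<comment> \<open>This is the quotient of \<open>factor M n - 1 / 6\<close> by \<open>p\<close>,
    with m = n if p = 6n+1 and m = n+1 if p = 6n+5.\<close>
  have D: "- 5 / of_nat (144 * m) \<in> D p" if "0 < m" "m < p" for m
  proof -
    have "\<not> p dvd m"
      using that by (auto dest: dvd_imp_le)
    hence "\<not> p dvd 144 * m"
      using not_dvd_144 p by (simp only: prime_dvd_mult_iff) simp
    thus ?thesis
      by (intro D_divide D_intros p)
  qed
  show ?thesis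
  proof (rule residue_cases)
    assume *: "p = 6 * n + 1" "M = 5 * n" "n > 0"
    have M: "M - n = 4 * n" "M + n + 1 = 6 * n + 1"
      using * by auto
    have "- ((6 * x + 1) * (6 * x + 5)) / (36 * (6 * x + 1) * (4 * x)) =
          1 / 6 + (6 * x + 1) * (- 5 / (144 * x))" if "x > 0" for x :: rat
    proof -
      have "6 * x + 1 \<noteq> 0"
        using that by auto
      thus ?thesis
        using that by (simp add: divide_simps) (simp add: algebra_simps)
    qed
    from this[of "of_nat n"] have "factor M n = 1 / 6 + of_nat p * (- 5 / of_nat (144 * n))"
      unfolding factor_def M *(1) of_nat_mult of_nat_add of_nat_numeral of_nat_1
      using *(3) by simp
    thus ?thesis
      using * by (intro rat_congI[OF p sixth D]) auto
  next
    assume *: "p = 6 * n + 5" "M = 5 * n + 4"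
    have M: "M - n = 4 * (n + 1)" "M + n + 1 = 6 * n + 5"
      using * by auto
    have "- ((6 * x + 1) * (6 * x + 5)) / (36 * (6 * x + 5) * (4 * (x + 1))) =
          1 / 6 + (6 * x + 5) * (- 5 / (144 * (x + 1)))" if "x \<ge> 0" for x :: rat
    proof -
      have "6 * x + 5 \<noteq> 0" "x + 1 \<noteq> 0"
        using that by auto
      thus ?thesis
        by (simp add: divide_simps) (simp add: algebra_simps)
    qed
    from this[of "of_nat n"] have "factor M n = 1 / 6 + of_nat p * (- 5 / of_nat (144 * (n + 1)))"
      unfolding factor_def M *(1) of_nat_mult of_nat_add of_nat_numeral of_nat_1
      by (simp only: of_nat_0_le_iff)
    thus ?thesis
      using * by (intro rat_congI[OF p sixth D]) auto
  qed
qed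

lemma prod_factor_small:
  assumes "k \<le> n"
  shows "rat_cong (\<Prod>j<k. factor n j) 1 p"
proof -
  have "rat_cong (\<Prod>j<k. factor n j) (\<Prod>j<k. 1) p"
  proof (rule rat_cong_prod[OF p])
    fix j assume "j \<in> {..<k}"
    with assms show "rat_cong (factor n j) 1 p"
      using bounds by (intro factor_cong_1 root_mod_p not_dvd_below_double) auto
  qed
  thus ?thesis
    by simp
qed

text \<open>For j < M the number M+j+1 is below 2p and equals \<open>p\<close> only at j = n, so
  only that factor differs from 1.\<close>

lemma prod_factor_large:
  assumes "k \<le> M"
  shows "rat_cong (\<Prod>j<k. factor M j) (if n < k then 1 / 6 else 1) p"
proof -
  have "rat_cong (\<Prod>j<k. factor M j) (\<Prod>j<k. if j = n then 1 / 6 else 1) p"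
  proof (rule rat_cong_prod[OF p])
    fix j assume j: "j \<in> {..<k}"
    show "rat_cong (factor M j) (if j = n then 1 / 6 else 1) p"
    proof (cases "j = n")
      case True
      thus ?thesis
        using factor_exceptional by simp
    next
      case False
      hence "rat_cong (factor M j) 1 p"
        using assms j bounds by (intro factor_cong_1 root_mod_p not_dvd_below_double) auto
      with False show ?thesis
        by simp
    qed
  qed
  thus ?thesis
    by simp
qed

section \<open>The coefficients and the numbers \<open>S k\<close> modulo \<open>p\<close>\<close>

text \<open>For k \<le> n both coefficients, times products congruent to 1, equal the same number
  2(2k+1) S_k. For n < k \<le> h both are divisible by \<open>p\<close>.\<close>

lemma wcoeff_cong:
  assumes "k \<le> h"
  shows "rat_cong (wcoeff M k) (wcoeff n k) p"
proof (cases "k \<le> n")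
  case True
  have "rat_cong (wcoeff M k * (\<Prod>j<k. factor M j)) (wcoeff M k * 1) p"
    using prod_factor_large[of k] True bounds by (intro rat_cong_mult_left p wcoeff_D) simp
  moreover have "rat_cong (wcoeff n k * (\<Prod>j<k. factor n j)) (wcoeff n k * 1) p"
    using prod_factor_small[of k] True by (intro rat_cong_mult_left p wcoeff_D)
  moreover have "wcoeff M k * (\<Prod>j<k. factor M j) = wcoeff n k * (\<Prod>j<k. factor n j)"
    using S_eq_wcoeff_prod[of k M] S_eq_wcoeff_prod[of k n] True bounds by simp
  ultimately show ?thesis
    using rat_cong_trans[OF p] rat_cong_sym[OF p] by (metis mult.right_neutral)
next
  case False
  \<comment> \<open>The bound k \<le> h gives 2k < p, while k > n gives M+k \<ge> M+n+1 = p.\<close>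
  have "p dvd ((2 * k + (M - k)) choose (2 * k))"
    using False assms bounds by (intro prime_dvd_choose_add p) auto
  moreover have "2 * k + (M - k) = M + k"
    using assms bounds by simp
  ultimately obtain q where "(M + k) choose (2 * k) = p * q"
    by (metis dvd_def)
  hence "wcoeff M k = wcoeff n k + of_nat p * (of_nat q * (- 432) ^ k)"
    using False by (simp add: wcoeff_def binomial_eq_0)
  thus ?thesis
    by (rule rat_congI[OF p, rotated 2]) (intro D_intros p wcoeff_D)+
qed

lemma D_divide_odd:
  assumes "k \<le> M" "k \<noteq> h" "a \<in> D p"
  shows "a / of_nat (2 * k + 1) \<in> D p"
  using assms bounds by (intro D_divide p not_dvd_below_double) auto

text \<open>Only k = h makes 2k+1 divisible by \<open>p\<close>; there c(n,h) = 0 forces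
  \<open>p\<close> to divide c(M,h).\<close>

lemma wcoeff_div_D:
  assumes "k \<le> M"
  shows "wcoeff M k / of_nat (2 * k + 1) \<in> D p"
proof (cases "k = h")
  case False
  thus ?thesis
    using assms by (intro D_divide_odd wcoeff_D)
next
  case True
  have "wcoeff n h = 0"
    using bounds by (simp add: wcoeff_eq_0)
  then obtain c where "c \<in> D p" "wcoeff M h = of_nat p * c"
    using wcoeff_cong[of h] unfolding rat_cong_def by auto
  moreover have "of_nat p \<noteq> (0 :: rat)"
    using p3 by simp
  ultimately show ?thesis
    unfolding True bounds(4) by simp
qed

lemma S_cong_small:
  assumes "k \<le> n"
  shows "rat_cong (of_nat (2 * k + 1) * S k) (1 / 2 * wcoeff n k) p"
    and "rat_cong (S k) (1 / 2 * (wcoeff n k / of_nat (2 * k + 1))) p"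
proof -
  define R where "R = (\<Prod>j<k. factor n j)"
  define d where "d = (of_nat (2 * k + 1) :: rat)"
  have d: "d \<noteq> 0"
    unfolding d_def of_nat_eq_0_iff by simp
  have S: "2 * d * S k = wcoeff n k * R"
    using S_eq_wcoeff_prod[OF assms] by (simp only: R_def d_def)
  have R: "rat_cong R 1 p"
    using prod_factor_small[OF assms] by (simp only: R_def)
  have half: "1 / 2 \<in> D p"
    by (intro D_divide_144 D_intros p) auto
  have "d * S k = (1 / 2 * wcoeff n k) * R"
    using S by simp
  moreover have "rat_cong ((1 / 2 * wcoeff n k) * R) (1 / 2 * wcoeff n k * 1) p"
    by (intro rat_cong_mult_left p D_mult half wcoeff_D R)
  ultimately show "rat_cong (of_nat (2 * k + 1) * S k) (1 / 2 * wcoeff n k) p"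
    by (simp only: d_def mult_1_right)
  have "S k = (1 / 2 * (wcoeff n k / d)) * R"
    using S d by (simp add: field_simps)
  moreover have "wcoeff n k / d \<in> D p"
    unfolding d_def using assms bounds by (intro D_divide_odd wcoeff_D) auto
  hence "rat_cong ((1 / 2 * (wcoeff n k / d)) * R) ((1 / 2 * (wcoeff n k / d)) * 1) p"
    by (intro rat_cong_mult_left p D_mult half R)
  ultimately show "rat_cong (S k) (1 / 2 * (wcoeff n k / of_nat (2 * k + 1))) p"
    by (simp only: d_def mult_1_right)
qed

text \<open>The 1/12 is 1/2 times the exceptional 1/6. The second congruence reduces an exact
  formula for \<open>S k\<close> instead of dividing the first one by 2k+1, which is
  \<open>p\<close> at k = h.\<close>

lemma S_cong_large:
  assumes "n < k" "k \<le> M"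
  shows "rat_cong (of_nat (2 * k + 1) * S k) (1 / 12 * wcoeff M k) p"
    and "rat_cong (S k) (1 / 12 * (wcoeff M k / of_nat (2 * k + 1))) p"
proof -
  define R where "R = (\<Prod>j<k. factor M j)"
  define d where "d = (of_nat (2 * k + 1) :: rat)"
  have d: "d \<noteq> 0"
    unfolding d_def of_nat_eq_0_iff by simp
  have S: "2 * d * S k = wcoeff M k * R"
    using S_eq_wcoeff_prod[OF assms(2)] by (simp only: R_def d_def)
  have R: "rat_cong R (1 / 6) p"
    using prod_factor_large[OF assms(2)] assms(1) by (simp add: R_def)
  have half: "1 / 2 \<in> D p"
    by (intro D_divide_144 D_intros p) auto
  have "d * S k = (1 / 2 * wcoeff M k) * R"
    using S by simp
  moreover have "rat_cong ((1 / 2 * wcoeff M k) * R) (1 / 2 * wcoeff M k * (1 / 6)) p"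
    by (intro rat_cong_mult_left p D_mult half wcoeff_D R)
  moreover have "1 / 2 * wcoeff M k * (1 / 6) = 1 / 12 * wcoeff M k"
    by simp
  ultimately show "rat_cong (of_nat (2 * k + 1) * S k) (1 / 12 * wcoeff M k) p"
    by (simp only: d_def)
  have "S k = (1 / 2 * (wcoeff M k / d)) * R"
    using S d by (simp add: field_simps)
  moreover have "wcoeff M k / d \<in> D p"
    unfolding d_def using assms by (intro wcoeff_div_D) auto
  hence "rat_cong ((1 / 2 * (wcoeff M k / d)) * R) ((1 / 2 * (wcoeff M k / d)) * (1 / 6)) p"
    by (intro rat_cong_mult_left p D_mult half R)
  moreover have "(1 / 2 * (wcoeff M k / d)) * (1 / 6) = 1 / 12 * (wcoeff M k / d)"
    by simp
  ultimately show "rat_cong (S k) (1 / 12 * (wcoeff M k / of_nat (2 * k + 1))) p"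
    by (simp only: d_def)
qed

section \<open>The Legendre symbol, differences of sums, and signs\<close>

text \<open>If p = 6n+1, then 3(2n+1) = p+2 and 3(2M+1) = 5p-2; if p = 6n+5, they are p-2 and 5p+2.
  The symbol, 1 or -1 respectively, removes this dependence on the case.\<close>

lemma Legendre_3:
  "rat_cong (of_int (Legendre (int p) 3) * of_nat (2 * n + 1)) (2 / 3) p"
  "rat_cong (of_int (Legendre (int p) 3) * of_nat (2 * M + 1)) (- (2 / 3)) p"
proof -
  have third: "1 / 3 \<in> D p" "2 / 3 \<in> D p" "5 / 3 \<in> D p" "- (2 / 3) \<in> D p"
    by (intro D_uminus D_divide_144 D_numeral p; simp)+
  have "rat_cong (of_int (Legendre (int p) 3) * of_nat (2 * n + 1)) (2 / 3) p \<and>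
        rat_cong (of_int (Legendre (int p) 3) * of_nat (2 * M + 1)) (- (2 / 3)) p"
  proof (rule residue_cases)
    assume *: "p = 6 * n + 1" "M = 5 * n"
    have "[int p = 1] (mod 3)"
      using *(1) by (simp add: cong_def) presburger
    hence "Legendre (int p) 3 = 1"
      unfolding Legendre_def QuadRes_def
      by (auto simp: cong_def intro!: exI[of _ 1])
    moreover have "of_nat (2 * n + 1) = (2 / 3 + of_nat p * (1 / 3) :: rat)"
      "of_nat (2 * M + 1) = (- (2 / 3) + of_nat p * (5 / 3) :: rat)"
      unfolding * by (simp_all add: field_simps)
    ultimately show ?thesis
      using rat_congI[OF p third(2) third(1)] rat_congI[OF p third(4) third(3)] by simp
  next
    assume *: "p = 6 * n + 5" "M = 5 * n + 4"
    have p2: "int p mod 3 = 2"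
      using *(1) by presburger
    have "y\<^sup>2 mod 3 \<noteq> 2" for y :: int
    proof -
      have "y mod 3 = 0 \<or> y mod 3 = 1 \<or> y mod 3 = 2"
        by presburger
      moreover have "y\<^sup>2 mod 3 = (y mod 3)\<^sup>2 mod 3"
        by (simp add: power_mod)
      ultimately show ?thesis
        by auto
    qed
    hence "Legendre (int p) 3 = - 1"
      using p2 unfolding Legendre_def QuadRes_def by (auto simp: cong_def)
    moreover have "- of_nat (2 * n + 1) = (2 / 3 + of_nat p * (- (1 / 3)) :: rat)"
      "- of_nat (2 * M + 1) = (- (2 / 3) + of_nat p * (- (5 / 3)) :: rat)"
      unfolding * by (simp_all add: field_simps)
    ultimately show ?thesis
      using rat_congI[OF p third(2) D_uminus[OF p third(1)]]
        rat_congI[OF p third(4) D_uminus[OF p third(3)]] by simp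
  qed
  thus "rat_cong (of_int (Legendre (int p) 3) * of_nat (2 * n + 1)) (2 / 3) p"
    "rat_cong (of_int (Legendre (int p) 3) * of_nat (2 * M + 1)) (- (2 / 3)) p"
    by blast+
qed

lemma sum_D: "(\<And>k. k \<in> A \<Longrightarrow> f k \<in> D p) \<Longrightarrow> sum f A \<in> D p"
  using rat_cong_sum[OF p rat_cong_refl[OF p], of A f] by (blast dest: rat_cong_D)

text \<open>Since \<open>g\<close> vanishes above \<open>n\<close>, its sum may be extended to all k
  < m, where it cancels the initial part of the sum of \<open>f\<close> modulo
  \<open>p\<close>.\<close>

lemma sum_diff_cong_tail:
  assumes t: "t \<in> D p" and m: "n < m" "m \<le> M"
    and f: "\<And>k. m \<le> k \<Longrightarrow> k \<le> M \<Longrightarrow> f k \<in> D p"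
    and fg: "\<And>k. k < m \<Longrightarrow> rat_cong (f k) (g k) p"
    and g: "\<And>k. n < k \<Longrightarrow> g k = 0"
  shows "rat_cong ((\<Sum>k\<le>M. f k * t ^ k) - (\<Sum>k\<le>n. g k * t ^ k)) (\<Sum>k=m..M. f k * t ^ k) p"
proof -
  have "{..M} = {..<m} \<union> {m..M}"
    using m by auto
  hence "(\<Sum>k\<le>M. f k * t ^ k) = (\<Sum>k<m. f k * t ^ k) + (\<Sum>k=m..M. f k * t ^ k)"
    by (simp add: sum.union_disjoint ivl_disj_int)
  moreover have "(\<Sum>k\<le>n. g k * t ^ k) = (\<Sum>k<m. g k * t ^ k)"
    using m g by (intro sum.mono_neutral_left) auto
  ultimately have eq: "(\<Sum>k\<le>M. f k * t ^ k) - (\<Sum>k\<le>n. g k * t ^ k) =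
      (\<Sum>k<m. f k * t ^ k) + ((\<Sum>k=m..M. f k * t ^ k) - (\<Sum>k<m. g k * t ^ k))"
    by simp
  have c: "rat_cong (\<Sum>k<m. f k * t ^ k) (\<Sum>k<m. g k * t ^ k) p"
    using fg t by (intro rat_cong_sum rat_cong_mult_right D_power p) auto
  have "rat_cong ((\<Sum>k<m. f k * t ^ k) + ((\<Sum>k=m..M. f k * t ^ k) - (\<Sum>k<m. g k * t ^ k)))
      ((\<Sum>k<m. g k * t ^ k) + ((\<Sum>k=m..M. f k * t ^ k) - (\<Sum>k<m. g k * t ^ k))) p"
  proof (intro rat_cong_add[OF p c] rat_cong_refl D_diff p)
    show "(\<Sum>k=m..M. f k * t ^ k) \<in> D p"
      using f t by (intro sum_D D_mult D_power p) auto
  qed (rule rat_cong_D(2)[OF c])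
  thus ?thesis
    unfolding eq by simp
qed

text \<open>Used to trade the sign (-1)^N of \<open>poly_w_even\<close> for (-1)^h.\<close>

lemma sign_eq: "(- 1 :: rat) ^ h * (- 1) ^ n = 1" "(- 1 :: rat) ^ h * (- 1) ^ M = 1"
proof -
  have "even (h + n)" "even (h + M)"
    by (rule residue_cases; simp)+
  thus "(- 1 :: rat) ^ h * (- 1) ^ n = 1" "(- 1 :: rat) ^ h * (- 1) ^ M = 1"
    by (simp_all add: power_add[symmetric])
qed

section \<open>The four congruences\<close>

context
  fixes t :: rat
  assumes t: "t \<in> D p"
begin

lemma sum_S_small:
  "rat_cong (\<Sum>k=0..n. S k * t ^ k)
     (3 / 4 * of_int (Legendre (int p) 3) * poly (w n) (1 - 216 * t)) p"
proof -
  define Q where "Q = (\<Sum>k\<le>n. wcoeff n k / of_nat (2 * k + 1) * t ^ k)"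
  have Q: "Q \<in> D p"
    unfolding Q_def using bounds t
    by (intro sum_D D_mult D_divide_odd wcoeff_D D_power p) auto
  have "rat_cong (\<Sum>k=0..n. S k * t ^ k) (\<Sum>k=0..n. 1 / 2 * (wcoeff n k / of_nat (2 * k + 1)) * t ^ k) p"
    using t by (intro rat_cong_sum rat_cong_mult_right S_cong_small D_power p) auto
  also have "(\<Sum>k=0..n. 1 / 2 * (wcoeff n k / of_nat (2 * k + 1)) * t ^ k) = 1 / 2 * Q"
    unfolding Q_def sum_distrib_left atLeast0AtMost by (simp only: mult.assoc)
  finally have 1: "rat_cong (\<Sum>k=0..n. S k * t ^ k) (1 / 2 * Q) p" .
  have "rat_cong (3 / 4 * (of_int (Legendre (int p) 3) * of_nat (2 * n + 1)) * Q) (3 / 4 * (2 / 3) * Q) p"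
    using Q by (intro rat_cong_mult_right rat_cong_mult_left Legendre_3 D_divide_144 D_numeral p) auto
  moreover have "3 / 4 * (2 / 3) * Q = 1 / 2 * Q"
    by simp
  moreover have "3 / 4 * of_int (Legendre (int p) 3) * poly (w n) (1 - 216 * t) =
      3 / 4 * (of_int (Legendre (int p) 3) * of_nat (2 * n + 1)) * Q"
    unfolding poly_w_odd Q_def by (simp only: mult.assoc)
  ultimately show ?thesis
    using rat_cong_trans[OF p 1 rat_cong_sym[OF p]] by (simp only:)
qed

lemma sum_S_large:
  "rat_cong (\<Sum>k=h..M. S k * t ^ k)
     (- (1 / 8) * of_int (Legendre (int p) 3)
        * (poly (w M) (1 - 216 * t) + poly (w n) (1 - 216 * t))) p"
proof -
  define L where "L = (of_int (Legendre (int p) 3) :: rat)"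
  define q where "q = (\<lambda>N k. wcoeff N k / of_nat (2 * k + 1))"
  define QM where "QM = (\<Sum>k\<le>M. q M k * t ^ k)"
  define Qn where "Qn = (\<Sum>k\<le>n. q n k * t ^ k)"
  define T where "T = (\<Sum>k=h..M. q M k * t ^ k)"
  have Dq: "q M k \<in> D p" if "k \<le> M" for k
    unfolding q_def using that by (rule wcoeff_div_D)
  have QM: "QM \<in> D p"
    unfolding QM_def using t by (intro sum_D D_mult D_power Dq p) auto
  have Qn: "Qn \<in> D p"
    unfolding Qn_def q_def using bounds t
    by (intro sum_D D_mult D_divide_odd wcoeff_D D_power p) auto
  have "rat_cong (\<Sum>k=h..M. S k * t ^ k) (\<Sum>k=h..M. 1 / 12 * q M k * t ^ k) p"
    unfolding q_def using t bounds
    by (intro rat_cong_sum rat_cong_mult_right S_cong_large D_power p) auto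
  also have "(\<Sum>k=h..M. 1 / 12 * q M k * t ^ k) = 1 / 12 * T"
    unfolding T_def sum_distrib_left by (simp only: mult.assoc)
  finally have 1: "rat_cong (\<Sum>k=h..M. S k * t ^ k) (1 / 12 * T) p" .
  have "rat_cong (QM - Qn) T p"
    unfolding QM_def Qn_def T_def
  proof (rule sum_diff_cong_tail[OF t])
    \<comment> \<open>The cut is at h: for k < h the number 2k+1 is a unit, so
      \<open>wcoeff_cong\<close> may be divided by it, whereas the term k = h must stay in the
      tail.\<close>
    show "n < h" "h \<le> M"
      using bounds by simp_all
    show "q M k \<in> D p" if "k \<le> M" for k
      using that by (rule Dq)
    show "q n k = 0" if "n < k" for k
      using that by (simp add: q_def wcoeff_eq_0)
    fix k assume k: "k < h"
    have "rat_cong (wcoeff M k * (1 / of_nat (2 * k + 1))) (wcoeff n k * (1 / of_nat (2 * k + 1))) p"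
      using k bounds by (intro rat_cong_mult_right wcoeff_cong D_divide_odd D_numeral p) auto
    thus "rat_cong (q M k) (q n k) p"
      by (simp add: q_def)
  qed
  hence 2: "rat_cong (1 / 12 * (QM - Qn)) (1 / 12 * T) p"
    by (intro rat_cong_mult_left D_divide_144 D_numeral p) auto
  have 3: "rat_cong (- (1 / 8) * (L * of_nat (2 * M + 1) * QM + L * of_nat (2 * n + 1) * Qn))
      (- (1 / 8) * (- (2 / 3) * QM + 2 / 3 * Qn)) p"
    unfolding L_def using QM Qn
    by (intro rat_cong_mult_left rat_cong_add rat_cong_mult_right Legendre_3
        D_uminus D_divide_144 D_numeral p) auto
  \<comment> \<open>The opposite signs of the residues 2/3 and -2/3 turn the sum of the two
    polynomials into the difference \<open>QM - Qn\<close>, and 1/8 * 2/3 = 1/12.\<close>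
  have "- (1 / 8) * (- (2 / 3) * QM + 2 / 3 * Qn) = 1 / 12 * (QM - Qn)"
    by (simp add: algebra_simps)
  moreover have "- (1 / 8) * L * (poly (w M) (1 - 216 * t) + poly (w n) (1 - 216 * t)) =
      - (1 / 8) * (L * of_nat (2 * M + 1) * QM + L * of_nat (2 * n + 1) * Qn)"
    unfolding poly_w_odd QM_def Qn_def q_def by (simp only: mult.assoc distrib_left)
  ultimately have "rat_cong (- (1 / 8) * L * (poly (w M) (1 - 216 * t) + poly (w n) (1 - 216 * t)))
      (1 / 12 * (QM - Qn)) p"
    using 3 by (simp only:)
  from rat_cong_trans[OF p 1 rat_cong_sym[OF p rat_cong_trans[OF p this 2]]] show ?thesis
    unfolding L_def .
qed

lemma sum_odd_S_small:
  "rat_cong (\<Sum>k=0..n. of_nat (2 * k + 1) * S k * t ^ k)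
     (1 / 2 * (- 1) ^ h * poly (w n) (216 * t - 1)) p"
proof -
  have "rat_cong (\<Sum>k=0..n. of_nat (2 * k + 1) * S k * t ^ k) (\<Sum>k=0..n. 1 / 2 * wcoeff n k * t ^ k) p"
    using t by (intro rat_cong_sum rat_cong_mult_right S_cong_small D_power p) auto
  also have "(\<Sum>k=0..n. 1 / 2 * wcoeff n k * t ^ k) =
      1 / 2 * ((- 1) ^ h * (- 1) ^ n * (\<Sum>k\<le>n. wcoeff n k * t ^ k))"
    unfolding sign_eq sum_distrib_left atLeast0AtMost by (simp only: mult.assoc mult_1_left)
  also have "\<dots> = 1 / 2 * (- 1) ^ h * poly (w n) (216 * t - 1)"
    unfolding poly_w_even by (simp only: mult.assoc)
  finally show ?thesis .
qed

lemma sum_odd_S_large: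
  "rat_cong (\<Sum>k=h + 1..M. of_nat (2 * k + 1) * S k * t ^ k)
     (1 / 12 * (- 1) ^ h * (poly (w M) (216 * t - 1) - poly (w n) (216 * t - 1))) p"
proof -
  define WM where "WM = (\<Sum>k\<le>M. wcoeff M k * t ^ k)"
  define Wn where "Wn = (\<Sum>k\<le>n. wcoeff n k * t ^ k)"
  define T where "T = (\<Sum>k=h + 1..M. wcoeff M k * t ^ k)"
  have "rat_cong (\<Sum>k=h + 1..M. of_nat (2 * k + 1) * S k * t ^ k) (\<Sum>k=h + 1..M. 1 / 12 * wcoeff M k * t ^ k) p"
    using t bounds by (intro rat_cong_sum rat_cong_mult_right S_cong_large D_power p) auto
  also have "(\<Sum>k=h + 1..M. 1 / 12 * wcoeff M k * t ^ k) = 1 / 12 * T"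
    unfolding T_def sum_distrib_left by (simp only: mult.assoc)
  finally have 1: "rat_cong (\<Sum>k=h + 1..M. of_nat (2 * k + 1) * S k * t ^ k) (1 / 12 * T) p" .
  have "rat_cong (WM - Wn) T p"
    unfolding WM_def Wn_def T_def
  proof (rule sum_diff_cong_tail[OF t])
    \<comment> \<open>Without the division by 2k+1, \<open>wcoeff_cong\<close> also covers k = h, so
      the tail starts one index later than for the sum without the factor 2k+1.\<close>
    show "n < h + 1" "h + 1 \<le> M"
      using bounds by simp_all
  qed (simp_all add: wcoeff_D wcoeff_cong wcoeff_eq_0)
  hence 2: "rat_cong (1 / 12 * (WM - Wn)) (1 / 12 * T) p"
    by (intro rat_cong_mult_left D_divide_144 D_numeral p) auto
  have "1 / 12 * (- 1) ^ h * (poly (w M) (216 * t - 1) - poly (w n) (216 * t - 1)) =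
      1 / 12 * ((- 1) ^ h * (- 1) ^ M * WM - (- 1) ^ h * (- 1) ^ n * Wn)"
    unfolding poly_w_even WM_def Wn_def by (simp only: mult.assoc right_diff_distrib)
  also have "\<dots> = 1 / 12 * (WM - Wn)"
    unfolding sign_eq by simp
  finally show ?thesis
    using rat_cong_trans[OF p 1 rat_cong_sym[OF p 2]] by simp
qed

end

end

theorem theorem32:
  fixes p :: nat and t :: rat
  assumes "prime p" and "p > 3" and "t \<in> D p"
  shows "rat_cong (\<Sum>k = 0..p div 6. S k * t ^ k)
           (3 / 4 * of_int (Legendre (int p) 3) * poly (w (p div 6)) (1 - 216 * t)) p
    \<and> rat_cong (\<Sum>k = (p - 1) div 2..5 * p div 6. S k * t ^ k)
           (- (1 / 8) * of_int (Legendre (int p) 3)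
             * (poly (w (5 * p div 6)) (1 - 216 * t) + poly (w (p div 6)) (1 - 216 * t))) p
    \<and> rat_cong (\<Sum>k = 0..p div 6. of_nat (2 * k + 1) * S k * t ^ k)
           (1 / 2 * (- 1) ^ ((p - 1) div 2) * poly (w (p div 6)) (216 * t - 1)) p
    \<and> rat_cong (\<Sum>k = (p + 1) div 2..5 * p div 6. of_nat (2 * k + 1) * S k * t ^ k)
           (1 / 12 * (- 1) ^ ((p - 1) div 2)
             * (poly (w (5 * p div 6)) (216 * t - 1) - poly (w (p div 6)) (216 * t - 1))) p"
proof -
  have "(p + 1) div 2 = (p - 1) div 2 + 1"
    using assms(2) by simp
  thus ?thesis
    using sum_S_small[OF assms] sum_S_large[OF assms] sum_odd_S_small[OF assms] sum_odd_S_large[OF assms]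
    by (simp only: simp_thms)
qed

end
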